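(* Let $J$ and $G$ be matching covered graphs, and let $S$ be a $2$-separation of $G$. If some marked $S$-component of $G$ is $J$-based, then $G$ is $J$-based.
   Context: Graphs loopless; multiple edges allowed. A connected graph with at least two vertices is matching covered if every edge lies in a perfect matching. A barrier of a graph with a perfect matching is a set $B$ of vertices such that the number of odd components of $G-B$ equals $|B|$. A $2$-separation of a matching covered graph $G$ is a set $S$ of two vertices such that $G-S$ is disconnected and $S$ is not a barrier. For $S=\{u,v\}$ and a component $L$ of $G-S$, the marked $S$-component corresponding to $L$ is $G[V(L)\cup S]+uv$, where a new edge joining $u,v$ is added. A subgraph $H$ is conformal if the graph minus $V(H)$ has a perfect matching; a bisubdivision of $J$ is obtained by replacing some edges of $J$ by paths with an even number of internal vertices; a graph is $J$-based if it has a conformal subgraph that is a bisubdivision of $J$. *)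

theory Defs
  imports Main
begin

text \<open>
  Multigraphs: edges are abstract objects and \<open>ends\<close> gives the set of end vertices of an edge,
  so parallel edges are distinct edges with the same ends. The values of \<open>ends\<close> outside
  \<open>edges\<close> are irrelevant.
\<close>

record ('v, 'e) mgraph =
  verts :: "'v set"
  edges :: "'e set"
  ends :: "'e \<Rightarrow> 'v set"

text \<open>Two distinct ends for every edge: no loops.\<close>

definition multigraph :: "('v, 'e) mgraph \<Rightarrow> bool" where
  "multigraph G \<longleftrightarrow> finite (verts G) \<and> finite (edges G) \<and>
     (\<forall>e \<in> edges G. ends G e \<subseteq> verts G \<and> card (ends G e) = 2)"

definition adj :: "('v, 'e) mgraph \<Rightarrow> ('v \<times> 'v) set" where
  "adj G = {(x, y). \<exists>e \<in> edges G. ends G e = {x, y}}"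

text \<open>The graph without vertices counts as connected, and it has no components.\<close>

definition connected_graph :: "('v, 'e) mgraph \<Rightarrow> bool" where
  "connected_graph G \<longleftrightarrow> (\<forall>u \<in> verts G. \<forall>v \<in> verts G. (u, v) \<in> (adj G)\<^sup>*)"

text \<open>Components are represented by their vertex sets.\<close>

definition components :: "('v, 'e) mgraph \<Rightarrow> 'v set set" where
  "components G = {{v \<in> verts G. (u, v) \<in> (adj G)\<^sup>*} | u. u \<in> verts G}"

definition induced :: "('v, 'e) mgraph \<Rightarrow> 'v set \<Rightarrow> ('v, 'e) mgraph" where
  "induced G X = \<lparr>verts = verts G \<inter> X, edges = {e \<in> edges G. ends G e \<subseteq> X}, ends = ends G\<rparr>"

definition delete_verts :: "('v, 'e) mgraph \<Rightarrow> 'v set \<Rightarrow> ('v, 'e) mgraph" where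
  "delete_verts G X = induced G (verts G - X)"

definition subgraph :: "('v, 'e) mgraph \<Rightarrow> ('v, 'e) mgraph \<Rightarrow> bool" where
  "subgraph H G \<longleftrightarrow> multigraph H \<and> verts H \<subseteq> verts G \<and> edges H \<subseteq> edges G \<and>
     (\<forall>e \<in> edges H. ends H e = ends G e)"

definition perfect_matching :: "('v, 'e) mgraph \<Rightarrow> 'e set \<Rightarrow> bool" where
  "perfect_matching G M \<longleftrightarrow> M \<subseteq> edges G \<and> (\<forall>v \<in> verts G. \<exists>!e. e \<in> M \<and> v \<in> ends G e)"

definition has_perfect_matching :: "('v, 'e) mgraph \<Rightarrow> bool" where
  "has_perfect_matching G \<longleftrightarrow> (\<exists>M. perfect_matching G M)"

definition matching_covered :: "('v, 'e) mgraph \<Rightarrow> bool" where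
  "matching_covered G \<longleftrightarrow> multigraph G \<and> connected_graph G \<and> card (verts G) \<ge> 2 \<and>
     (\<forall>e \<in> edges G. \<exists>M. perfect_matching G M \<and> e \<in> M)"

definition odd_components :: "('v, 'e) mgraph \<Rightarrow> 'v set set" where
  "odd_components G = {C \<in> components G. odd (card C)}"

definition barrier :: "('v, 'e) mgraph \<Rightarrow> 'v set \<Rightarrow> bool" where
  "barrier G B \<longleftrightarrow> has_perfect_matching G \<and> B \<subseteq> verts G \<and>
     card (odd_components (delete_verts G B)) = card B"

definition two_separation :: "('v, 'e) mgraph \<Rightarrow> 'v set \<Rightarrow> bool" where
  "two_separation G S \<longleftrightarrow> matching_covered G \<and> S \<subseteq> verts G \<and> card S = 2 \<and>
     \<not> connected_graph (delete_verts G S) \<and> \<not> barrier G S"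

text \<open>
  The edge \<open>None\<close> is the new edge joining the two vertices of \<open>S\<close>; it is parallel to any
  edges \<open>Some e\<close> that already join them in \<open>G\<close>.
\<close>

definition marked_component ::
    "('v, 'e) mgraph \<Rightarrow> 'v set \<Rightarrow> 'v set \<Rightarrow> ('v, 'e option) mgraph" where
  "marked_component G S L =
     \<lparr>verts = verts (induced G (L \<union> S)),
      edges = insert None (Some ` edges (induced G (L \<union> S))),
      ends = case_option S (ends G)\<rparr>"

text \<open>A path is given by its vertex sequence and its edge sequence.\<close>

definition is_path :: "('v, 'e) mgraph \<Rightarrow> 'v list \<Rightarrow> 'e list \<Rightarrow> bool" where
  "is_path G xs es \<longleftrightarrow> length xs = Suc (length es) \<and> distinct xs \<and>
     set xs \<subseteq> verts G \<and> set es \<subseteq> edges G \<and>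
     (\<forall>i < length es. ends G (es ! i) = {xs ! i, xs ! Suc i})"

definition internal :: "'v list \<Rightarrow> 'v list" where
  "internal xs = butlast (tl xs)"

text \<open>
  \<open>H\<close> is, up to isomorphism, obtained from \<open>J\<close> by replacing each edge \<open>e\<close> by the path
  with vertices \<open>P e\<close> and edges \<open>Q e\<close>; edges that are kept correspond to paths without
  internal vertices. The map \<open>f\<close> embeds the vertices of \<open>J\<close> into \<open>H\<close>.
\<close>

definition bisubdivision :: "('a, 'b) mgraph \<Rightarrow> ('v, 'e) mgraph \<Rightarrow> bool" where
  "bisubdivision J H \<longleftrightarrow> (\<exists>f P Q.
     inj_on f (verts J) \<and>
     (\<forall>e \<in> edges J. is_path H (P e) (Q e) \<and> {hd (P e), last (P e)} = f ` ends J e \<and>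
        even (length (internal (P e))) \<and> set (internal (P e)) \<inter> f ` verts J = {}) \<and>
     (\<forall>e \<in> edges J. \<forall>e' \<in> edges J. e \<noteq> e' \<longrightarrow>
        set (internal (P e)) \<inter> set (internal (P e')) = {} \<and> set (Q e) \<inter> set (Q e') = {}) \<and>
     verts H = f ` verts J \<union> (\<Union>e \<in> edges J. set (internal (P e))) \<and>
     edges H = (\<Union>e \<in> edges J. set (Q e)))"

definition conformal :: "('v, 'e) mgraph \<Rightarrow> ('v, 'e) mgraph \<Rightarrow> bool" where
  "conformal H G \<longleftrightarrow> subgraph H G \<and> has_perfect_matching (delete_verts G (verts H))"

definition based :: "('a, 'b) mgraph \<Rightarrow> ('v, 'e) mgraph \<Rightarrow> bool" where
  "based J G \<longleftrightarrow> (\<exists>H. conformal H G \<and> bisubdivision J H)"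

end

theory Submission
  imports Defs
begin

text \<open>
  Let \<open>S = {u, v}\<close>, let \<open>L\<close> be the chosen component of \<open>G - S\<close> and \<open>W\<close> the rest of \<open>G - S\<close>. As \<open>S\<close>
  is not a barrier, \<open>L\<close> and \<open>W\<close> are even, so by parity some perfect matching of \<open>G\<close> matches both
  vertices of \<open>S\<close> into \<open>W\<close>, and some other one matches both into \<open>L\<close>. The first contains a perfect
  matching \<open>N\<close> of \<open>G[W \<union> S]\<close>, the second a perfect matching \<open>K\<close> of \<open>G[W]\<close>. Consider the conformal
  bisubdivision \<open>H\<close> in the marked component and a perfect matching \<open>M\<close> of its complement. If the new
  edge is in neither, add \<open>K\<close> to \<open>M\<close>. If it is in \<open>M\<close>, replace it by \<open>N\<close>. If it is in \<open>H\<close>, replace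
  it by the path from \<open>u\<close> to \<open>v\<close> that alternates between \<open>N\<close> and \<open>K\<close>; the rest of \<open>W\<close> is matched
  by \<open>N\<close>.
\<close>

section \<open>Matchings of vertex sets\<close>

text \<open>Only the end function \<open>E\<close> enters, not a graph, so matchings of vertex sets
  can be cut and united without forming the induced subgraphs. The clause
  \<open>E e \<subseteq> X\<close> forbids edges that leave \<open>X\<close>.\<close>

definition matches :: "('e \<Rightarrow> 'v set) \<Rightarrow> 'e set \<Rightarrow> 'v set \<Rightarrow> bool" where
  "matches E M X \<longleftrightarrow> (\<forall>e \<in> M. E e \<subseteq> X \<and> card (E e) = 2) \<and> (\<forall>x \<in> X. \<exists>!e. e \<in> M \<and> x \<in> E e)"

lemma matches_ends: "matches E M X \<Longrightarrow> e \<in> M \<Longrightarrow> E e \<subseteq> X"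
  by (auto simp: matches_def)

lemma matches_card: "matches E M X \<Longrightarrow> e \<in> M \<Longrightarrow> card (E e) = 2"
  by (auto simp: matches_def)

lemma matches_unique:
  assumes "matches E M X" "e \<in> M" "f \<in> M" "x \<in> E e" "x \<in> E f"
  shows "e = f"
proof -
  have "x \<in> X" using matches_ends[OF assms(1,2)] assms(4) by auto
  then have "\<exists>!d. d \<in> M \<and> x \<in> E d" using assms(1) by (simp add: matches_def)
  then show ?thesis using assms(2-5) by blast
qed

lemma matches_cover:
  assumes "matches E M X" "x \<in> X"
  shows "\<exists>e \<in> M. x \<in> E e"
proof -
  have "\<exists>!e. e \<in> M \<and> x \<in> E e" using assms by (simp add: matches_def)
  then show ?thesis by blast
qed

lemma matches_partner:
  assumes "matches E M X" "x \<in> X"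
  shows "\<exists>e \<in> M. \<exists>y \<in> X. E e = {x, y} \<and> x \<noteq> y"
proof -
  obtain e where e: "e \<in> M" "x \<in> E e" using matches_cover[OF assms] by blast
  have "card (E e) = 2" "E e \<subseteq> X" using assms e by (auto simp: matches_def)
  moreover from this obtain y where "E e = {x, y}" "x \<noteq> y"
    using e(2) by (auto simp: card_2_iff doubleton_eq_iff)
  ultimately show ?thesis using e(1) by blast
qed

lemma matchesI:
  assumes "\<And>e. e \<in> M \<Longrightarrow> E e \<subseteq> X" "\<And>e. e \<in> M \<Longrightarrow> card (E e) = 2"
    and "\<And>x. x \<in> X \<Longrightarrow> \<exists>e \<in> M. x \<in> E e"
    and "\<And>x e f. e \<in> M \<Longrightarrow> f \<in> M \<Longrightarrow> x \<in> E e \<Longrightarrow> x \<in> E f \<Longrightarrow> e = f"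
  shows "matches E M X"
  unfolding matches_def using assms by blast

lemma matches_union:
  assumes M: "matches E M X" and N: "matches E N Y" and XY: "X \<inter> Y = {}"
  shows "matches E (M \<union> N) (X \<union> Y)"
proof (rule matchesI)
  fix x e f
  assume ef: "e \<in> M \<union> N" "f \<in> M \<union> N" "x \<in> E e" "x \<in> E f"
  have side: "d \<in> M \<and> x \<in> X \<or> d \<in> N \<and> x \<in> Y" if "d \<in> M \<union> N" "x \<in> E d" for d
    using that matches_ends[OF M, of d] matches_ends[OF N, of d] by blast
  have "e \<in> M \<and> f \<in> M \<or> e \<in> N \<and> f \<in> N"
    using side[OF ef(1,3)] side[OF ef(2,4)] XY by blast
  then show "e = f"
    using matches_unique[OF M _ _ ef(3,4)] matches_unique[OF N _ _ ef(3,4)] by blast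
next
  fix x assume "x \<in> X \<union> Y"
  then show "\<exists>e \<in> M \<union> N. x \<in> E e"
    using matches_cover[OF M, of x] matches_cover[OF N, of x] by blast
next
  fix e assume "e \<in> M \<union> N"
  then show "E e \<subseteq> X \<union> Y" "card (E e) = 2"
    using matches_ends[OF M, of e] matches_ends[OF N, of e] matches_card[OF M, of e]
      matches_card[OF N, of e] by auto
qed

text \<open>By \<open>cl\<close> no edge of \<open>M\<close> crosses the boundary of
  \<open>Y\<close>, so the edge that covers a vertex of \<open>Y\<close> survives the
  restriction.\<close>

lemma matches_restrict:
  assumes M: "matches E M X" and "Y \<subseteq> X"
    and cl: "\<And>e. e \<in> M \<Longrightarrow> E e \<inter> Y \<noteq> {} \<Longrightarrow> E e \<subseteq> Y"
  shows "matches E {e \<in> M. E e \<subseteq> Y} Y"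
proof (rule matchesI)
  fix x assume x: "x \<in> Y"
  then obtain e where "e \<in> M" "x \<in> E e" using matches_cover[OF M] \<open>Y \<subseteq> X\<close> by blast
  then show "\<exists>e \<in> {e \<in> M. E e \<subseteq> Y}. x \<in> E e" using cl x by blast
qed (auto intro: matches_card[OF M] matches_unique[OF M])

lemma matches_remove:
  assumes M: "matches E M X" and e: "e \<in> M"
  shows "matches E (M - {e}) (X - E e)"
proof (rule matchesI)
  fix x assume x: "x \<in> X - E e"
  then obtain f where "f \<in> M" "x \<in> E f" using matches_cover[OF M] by blast
  then show "\<exists>f \<in> M - {e}. x \<in> E f" using x by blast
next
  fix f assume "f \<in> M - {e}"
  then show "E f \<subseteq> X - E e"
    using matches_unique[OF M _ e, of f] matches_ends[OF M, of f] by blast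
qed (auto intro: matches_card[OF M] matches_unique[OF M])

lemma matches_even:
  assumes M: "matches E M X" and "finite X"
  shows "even (card X)"
proof -
  have X: "X = (\<Union>e \<in> M. E e)"
    using matches_ends[OF M] matches_cover[OF M] by fast
  \<comment> \<open>Finiteness of \<open>M\<close> is not assumed. It follows from that of
    \<open>X\<close>, because disjoint nonempty end sets make \<open>E\<close> injective on
    \<open>M\<close>.\<close>
  have inj: "inj_on E M"
  proof (rule inj_onI)
    fix e f assume ef: "e \<in> M" "f \<in> M" "E e = E f"
    obtain x where "x \<in> E e" using matches_card[OF M \<open>e \<in> M\<close>] by fastforce
    then show "e = f" using matches_unique[OF M ef(1,2)] ef(3) by blast
  qed
  have "finite (E ` M)"
    using matches_ends[OF M] \<open>finite X\<close> by (auto intro: finite_subset[of _ "Pow X"])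
  then have fin: "finite M" using inj finite_imageD by blast
  have "card (\<Union>e \<in> M. E e) = (\<Sum>e \<in> M. card (E e))"
  proof (rule card_UN_disjoint[OF fin])
    show "\<forall>i\<in>M. finite (E i)"
      using matches_card[OF M] by (metis card.infinite zero_neq_numeral)
    show "\<forall>i\<in>M. \<forall>j\<in>M. i \<noteq> j \<longrightarrow> E i \<inter> E j = {}"
      by (blast dest: matches_unique[OF M])
  qed
  also have "\<dots> = 2 * card M" using matches_card[OF M] by simp
  finally show ?thesis using X by simp
qed

text \<open>If no edge of \<open>M\<close> left \<open>Y\<close>, then \<open>M\<close> would
  restrict to a perfect matching of the odd set \<open>Y\<close>.\<close>

lemma odd_matched_outside:
  assumes M: "matches E M X" and "finite X" "Y \<subseteq> X" "odd (card Y)"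
  shows "\<exists>e \<in> M. \<exists>y \<in> Y. \<exists>z \<in> X - Y. E e = {y, z}"
proof -
  have "\<exists>e \<in> M. E e \<inter> Y \<noteq> {} \<and> \<not> E e \<subseteq> Y"
  proof (rule ccontr)
    assume "\<not> ?thesis"
    then have "matches E {e \<in> M. E e \<subseteq> Y} Y"
      using matches_restrict[OF M \<open>Y \<subseteq> X\<close>] by blast
    then show False using matches_even assms finite_subset by blast
  qed
  then obtain e y where e: "e \<in> M" "y \<in> E e" "y \<in> Y" "\<not> E e \<subseteq> Y" by blast
  then obtain f z where f: "f \<in> M" "E f = {y, z}" "z \<in> X"
    using matches_partner[OF M, of y] \<open>Y \<subseteq> X\<close> by blast
  have "f = e" using matches_unique[OF M f(1) e(1) _ e(2)] f(2) by simp
  then show ?thesis using e f by auto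
qed

section \<open>Transfer of \<open>matches\<close> to edges wrapped in \<open>Some\<close> and to
  perfect matchings\<close>

lemma matches_Some:
  "matches (case_option S F) (Some ` M) X \<longleftrightarrow> matches F M X"
proof -
  have ex1: "(\<exists>!e. e \<in> A \<and> P e) \<longleftrightarrow> (\<exists>e \<in> A. P e \<and> (\<forall>d \<in> A. P d \<longrightarrow> d = e))" for A :: "'z set" and P
    by (auto simp: Ex1_def)
  show ?thesis unfolding matches_def ex1 by simp
qed

lemma perfect_matching_iff:
  assumes "multigraph G"
  shows "perfect_matching G M \<longleftrightarrow> M \<subseteq> edges G \<and> matches (ends G) M (verts G)"
  using assms unfolding perfect_matching_def matches_def multigraph_def by (auto simp: subset_iff)

lemma multigraph_delete_verts: "multigraph G \<Longrightarrow> multigraph (delete_verts G X)"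
  unfolding multigraph_def delete_verts_def induced_def by auto

lemma has_perfect_matching_delete_iff:
  assumes "multigraph G"
  shows "has_perfect_matching (delete_verts G X) \<longleftrightarrow>
    (\<exists>M \<subseteq> edges G. matches (ends G) M (verts G - X))"
proof -
  have "perfect_matching (delete_verts G X) M \<longleftrightarrow>
      M \<subseteq> edges G \<and> matches (ends G) M (verts G - X)" for M
    unfolding perfect_matching_iff[OF multigraph_delete_verts[OF assms]]
    by (auto simp: delete_verts_def induced_def Int_absorb1 Diff_subset dest: matches_ends)
  then show ?thesis unfolding has_perfect_matching_def by blast
qed

section \<open>Paths\<close>

lemma is_path_single: "is_path D [x] [] \<longleftrightarrow> x \<in> verts D"
  by (auto simp: is_path_def)

lemma is_path_length: "is_path D xs es \<Longrightarrow> length xs = Suc (length es)"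
  by (simp add: is_path_def)

lemma is_path_Cons:
  "is_path D (x # xs) (e # es) \<longleftrightarrow> x \<in> verts D \<and> x \<notin> set xs \<and> e \<in> edges D \<and>
     ends D e = {x, hd xs} \<and> is_path D xs es"
proof (cases xs)
  case (Cons y ys)
  have "(\<forall>i < length (e # es). ends D ((e # es) ! i) = {(x # xs) ! i, (x # xs) ! Suc i}) \<longleftrightarrow>
      ends D e = {x, hd xs} \<and> (\<forall>i < length es. ends D (es ! i) = {xs ! i, xs ! Suc i})"
    using Cons by (auto simp: less_Suc_eq_0_disj)
  then show ?thesis unfolding is_path_def by auto
qed (auto simp: is_path_def)

lemma is_path_append:
  assumes "length xs = Suc (length es)" "ys \<noteq> []"
  shows "is_path D (xs @ ys) (es @ e # fs) \<longleftrightarrow> is_path D xs es \<and> is_path D ys fs \<and>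
     set xs \<inter> set ys = {} \<and> e \<in> edges D \<and> ends D e = {last xs, hd ys}"
  using assms
proof (induction es arbitrary: xs)
  case Nil
  then obtain x where "xs = [x]" by (auto simp: length_Suc_conv)
  then show ?case by (auto simp: is_path_Cons is_path_single)
next
  case (Cons d es)
  then obtain x xs' where xs: "xs = x # xs'" "length xs' = Suc (length es)"
    by (auto simp: length_Suc_conv)
  then have "xs' \<noteq> []" by auto
  then show ?case using Cons.IH[OF xs(2)] Cons.prems xs by (auto simp: is_path_Cons)
qed

lemma is_path_rev: "is_path D xs es \<Longrightarrow> is_path D (rev xs) (rev es)"
proof (induction es arbitrary: xs)
  case Nil
  then obtain x where "xs = [x]" by (auto simp: length_Suc_conv is_path_def)
  then show ?case using Nil by simp
next
  case (Cons e es)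
  then obtain x xs' where xs: "xs = x # xs'" "length xs' = Suc (length es)"
    by (auto simp: length_Suc_conv is_path_def)
  then have "xs' \<noteq> []" by auto
  then show ?case using Cons xs
    by (auto simp: is_path_Cons is_path_append is_path_single last_rev)
qed

lemma is_path_mono:
  assumes "is_path D xs es" "set xs \<subseteq> verts D'" "set es \<subseteq> edges D'"
    and "\<And>e. e \<in> set es \<Longrightarrow> ends D' e = ends D e"
  shows "is_path D' xs es"
  using assms unfolding is_path_def by auto

lemma is_path_ends:
  assumes "is_path D xs es" "e \<in> set es"
  shows "ends D e \<subseteq> set xs"
proof -
  obtain i where "i < length es" "es ! i = e" using assms by (auto simp: in_set_conv_nth)
  then show ?thesis using assms by (auto simp: is_path_def)
qed

text \<open>Serves to replace the edge between \<open>last p\<close> and \<open>hd p'\<close> of a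
  path by a path with internal vertices \<open>r\<close>. The list \<open>es\<close> has one edge
  more than \<open>r\<close> has vertices.\<close>

lemma is_path_splice:
  assumes p: "is_path D p q" and p': "is_path D p' q'" "set p \<inter> set p' = {}"
    and r: "is_path D (last p # r @ [hd p']) es" "set r \<inter> (set p \<union> set p') = {}"
  shows "is_path D (p @ r @ p') (q @ es @ q')"
proof -
  have ne: "p' \<noteq> []" using is_path_length[OF p'(1)] by auto
  note len = is_path_length[OF p] is_path_length[OF p'(1)] is_path_length[OF r(1)]
  then obtain e es' where es: "es = e # es'" by (cases es) auto
  show ?thesis
  proof (cases r rule: rev_cases)
    case Nil
    then show ?thesis using len es p p' r ne by (simp add: is_path_append is_path_Cons)
  next
    case (snoc r' z)
    then obtain f es'' where es': "es' = es'' @ [f]" using es len by (cases es' rule: rev_cases) auto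
    \<comment> \<open>The edges \<open>e\<close> and \<open>f\<close> attach \<open>r\<close> to the
      two halves, and \<open>es''\<close> runs inside \<open>r\<close>.\<close>
    have r1: "r \<noteq> []" and lr: "length r = Suc (length es'')" using snoc es es' len by auto
    have "is_path D (r @ [hd p']) (es'' @ f # [])" "e \<in> edges D" "ends D e = {last p, hd r}"
      using r r1 es es' by (auto simp: is_path_Cons)
    then have "is_path D r es''" "f \<in> edges D" "ends D f = {last r, hd p'}"
      using is_path_append[OF lr, of "[hd p']"] by auto
    then have "is_path D (r @ p') (es'' @ f # q')"
      using is_path_append[OF lr ne] p' r by auto
    then show ?thesis
      using is_path_append[OF len(1), of "r @ p'"] r1 p p' r es es' \<open>e \<in> edges D\<close>
        \<open>ends D e = {last p, hd r}\<close> by auto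
  qed
qed

text \<open>
  Follow the path that starts at \<open>u\<close> and alternates between \<open>N\<close> and \<open>K\<close>. After two steps it has
  reached a vertex that plays the role of \<open>u\<close> for the remaining vertices, and it can only stop
  at \<open>v\<close>.
\<close>

lemma alternating_path:
  assumes "finite W" "u \<noteq> v" "u \<notin> W" "v \<notin> W"
    and "matches (ends D) N (W \<union> {u, v})" "matches (ends D) K W"
    and "N \<subseteq> edges D" "K \<subseteq> edges D" "W \<union> {u, v} \<subseteq> verts D"
  shows "\<exists>r es. is_path D (u # r @ [v]) es \<and> set es \<subseteq> N \<union> K \<and> even (length r) \<and> set r \<subseteq> W \<and>
    (\<exists>N' \<subseteq> N. matches (ends D) N' (W - set r))"
  using assms
proof (induction "card W" arbitrary: W u N K rule: less_induct)
  case less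
  obtain e w where e: "e \<in> N" "ends D e = {u, w}" "u \<noteq> w" "w \<in> W \<union> {u, v}"
    using matches_partner[OF less.prems(5)] by blast
  have N': "matches (ends D) (N - {e}) (W \<union> {u, v} - {u, w})"
    using matches_remove[OF less.prems(5) e(1)] e(2) by simp
  show ?case
  \<comment> \<open>If \<open>w = v\<close>, the path is the single edge \<open>e\<close>, and
    \<open>N - {e}\<close> already matches all of \<open>W\<close>. Otherwise the edge of
    \<open>K\<close> at \<open>w\<close> leads on to \<open>x\<close>, the new start.\<close>
  proof (cases "w = v")
    case True
    then have "W \<union> {u, v} - {u, w} = W" using less.prems by auto
    then have "matches (ends D) (N - {e}) (W - set [])" using N' by simp
    moreover have "is_path D (u # [] @ [v]) [e]"
      using less.prems e True by (auto simp: is_path_Cons is_path_single)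
    ultimately show ?thesis using e(1)
      by (intro exI[of _ "[]"] exI[of _ "[e]"]) (auto intro: exI[of _ "N - {e}"])
  next
    case False
    then have w: "w \<in> W" using e by auto
    obtain f x where f: "f \<in> K" "ends D f = {w, x}" "w \<noteq> x" "x \<in> W"
      using matches_partner[OF less.prems(6) w] by blast
    let ?W = "W - {w, x}"
    have "W \<union> {u, v} - {u, w} = ?W \<union> {x, v}" using less.prems f False by auto
    then have N'': "matches (ends D) (N - {e}) (?W \<union> {x, v})" using N' by simp
    have K': "matches (ends D) (K - {f}) ?W"
      using matches_remove[OF less.prems(6) f(1)] f(2) by simp
    have "card ?W < card W" using less.prems(1) w by (intro psubset_card_mono) auto
    then have "\<exists>r es. is_path D (x # r @ [v]) es \<and> set es \<subseteq> (N - {e}) \<union> (K - {f}) \<and> even (length r) \<and>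
        set r \<subseteq> ?W \<and> (\<exists>N' \<subseteq> N - {e}. matches (ends D) N' (?W - set r))"
      by (rule less.hyps[OF _ _ _ _ _ N'' K']) (use less.prems f in auto)
    then obtain r es M where r: "is_path D (x # r @ [v]) es" "set es \<subseteq> (N - {e}) \<union> (K - {f})"
      "even (length r)" "set r \<subseteq> ?W" "M \<subseteq> N - {e}" "matches (ends D) M (?W - set r)"
      by (elim exE conjE)
    have "is_path D (u # (w # x # r) @ [v]) (e # f # es)"
      using r(1,4) e f w False less.prems by (auto simp: is_path_Cons)
    moreover have "set (e # f # es) \<subseteq> N \<union> K" "even (length (w # x # r))" "set (w # x # r) \<subseteq> W"
      using r(2-4) e(1) f w by auto
    \<comment> \<open>Both removed vertices lie on the extended path, so the matching of the rest is
      kept unchanged.\<close>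
    moreover have "?W - set r = W - set (w # x # r)" by auto
    then have "matches (ends D) M (W - set (w # x # r))" using r(6) by simp
    then have "\<exists>N' \<subseteq> N. matches (ends D) N' (W - set (w # x # r))"
      by (rule exI[of _ M, OF conjI, rotated]) (use r(5) in blast)
    ultimately show ?thesis
      by (intro exI[of _ "w # x # r"] exI[of _ "e # f # es"] conjI)
  qed
qed

section \<open>Bisubdivisions\<close>

lemma internal_Cons_snoc: "internal (x # xs @ [y]) = xs"
  by (simp add: internal_def)

lemma path_split:
  assumes "is_path D p q" "g \<in> set q"
  obtains p1 q1 p2 q2 where "p = p1 @ p2" "q = q1 @ g # q2" "is_path D p1 q1" "is_path D p2 q2"
    "set p1 \<inter> set p2 = {}" "ends D g = {last p1, hd p2}" "p1 \<noteq> []" "p2 \<noteq> []"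
proof -
  obtain q1 q2 where q: "q = q1 @ g # q2" using assms(2) by (meson split_list)
  let ?p1 = "take (Suc (length q1)) p" and ?p2 = "drop (Suc (length q1)) p"
  have len: "length p = Suc (length q)" using is_path_length[OF assms(1)] .
  then have "length ?p1 = Suc (length q1)" "?p2 \<noteq> []" using q by auto
  from is_path_append[OF this, of D g q2] assms(1) q
  show thesis using that[of ?p1 ?p2 q1 q2] \<open>?p2 \<noteq> []\<close> len by fastforce
qed

text \<open>The edge \<open>g\<close> lies on the path of exactly one edge \<open>d\<close> of
  \<open>J\<close>. Splicing \<open>r\<close> into that path adds an even number of internal
  vertices, and freshness keeps all the paths disjoint.\<close>

lemma bisubdivision_replace_edge:
  assumes bis: "bisubdivision J H" and g: "g \<in> edges H" "ends H g = {a, b}" "a \<noteq> b"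
    and vH': "verts H' = verts H \<union> set r" and eH': "edges H' = edges H - {g} \<union> set es"
    and ends: "\<And>e. e \<in> edges H - {g} \<Longrightarrow> ends H' e = ends H e"
    and R: "is_path H' (a # r @ [b]) es"
    and fresh: "set r \<inter> verts H = {}" "set es \<inter> edges H = {}" and ev: "even (length r)"
  shows "bisubdivision J H'"
proof -
  obtain f P Q where inj: "inj_on f (verts J)"
    and path: "\<And>e. e \<in> edges J \<Longrightarrow> is_path H (P e) (Q e)"
    and hl: "\<And>e. e \<in> edges J \<Longrightarrow> {hd (P e), last (P e)} = f ` ends J e"
    and evP: "\<And>e. e \<in> edges J \<Longrightarrow> even (length (internal (P e)))"
    and intP: "\<And>e. e \<in> edges J \<Longrightarrow> set (internal (P e)) \<inter> f ` verts J = {}"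
    and disP: "\<And>e e'. e \<in> edges J \<Longrightarrow> e' \<in> edges J \<Longrightarrow> e \<noteq> e' \<Longrightarrow>
        set (internal (P e)) \<inter> set (internal (P e')) = {}"
    and disQ: "\<And>e e'. e \<in> edges J \<Longrightarrow> e' \<in> edges J \<Longrightarrow> e \<noteq> e' \<Longrightarrow> set (Q e) \<inter> set (Q e') = {}"
    and vH: "verts H = f ` verts J \<union> (\<Union>e \<in> edges J. set (internal (P e)))"
    and eH: "edges H = (\<Union>e \<in> edges J. set (Q e))"
    using bis unfolding bisubdivision_def by (elim exE conjE) blast
  obtain d where d: "d \<in> edges J" "g \<in> set (Q d)" using g eH by blast
  obtain p1 q1 p2 q2 where s: "P d = p1 @ p2" "Q d = q1 @ g # q2" "is_path H p1 q1"
    "is_path H p2 q2" "set p1 \<inter> set p2 = {}" "ends H g = {last p1, hd p2}" "p1 \<noteq> []" "p2 \<noteq> []"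
    using path_split[OF path[OF d(1)] d(2)] .
  \<comment> \<open>The path of \<open>d\<close> may traverse \<open>g\<close> from \<open>b\<close>
    to \<open>a\<close>; the new path is then inserted in reverse.\<close>
  obtain r' es' where r': "is_path H' (last p1 # r' @ [hd p2]) es'" "set r' = set r"
    "length r' = length r" "set es' = set es"
  proof (cases "last p1 = a")
    case True
    then have "hd p2 = b" using s(6) g by (auto simp: doubleton_eq_iff)
    then show thesis using True R that[of r es] by simp
  next
    case False
    then have "hd p2 = a" "last p1 = b" using s(6) g by (auto simp: doubleton_eq_iff)
    then show thesis using is_path_rev[OF R] that[of "rev r" "rev es"] by simp
  qed
  \<comment> \<open>A second occurrence of \<open>g\<close> would put both its ends into one half,
    but it has an end in each of the disjoint halves.\<close>
  have gq: "g \<notin> set q1" "g \<notin> set q2"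
    using is_path_ends[OF s(3), of g] is_path_ends[OF s(4), of g] s(5,6)
      last_in_set[OF s(7)] hd_in_set[OF s(8)] by auto
  have Hsub: "is_path H' p q" if "is_path H p q" "g \<notin> set q" for p q
  proof (rule is_path_mono[OF that(1)])
    show "set p \<subseteq> verts H'" "set q \<subseteq> edges H'" using that vH' eH' by (auto simp: is_path_def)
    show "ends H' e = ends H e" if "e \<in> set q" for e
      by (rule ends) (use \<open>is_path H p q\<close> \<open>g \<notin> set q\<close> that in \<open>auto simp: is_path_def\<close>)
  qed
  have pv: "set p1 \<union> set p2 \<subseteq> verts H" using s by (auto simp: is_path_def)
  have new: "is_path H' (p1 @ r' @ p2) (q1 @ es' @ q2)"
    using is_path_splice[OF Hsub[OF s(3) gq(1)] Hsub[OF s(4) gq(2)] s(5) r'(1)] r' fresh pv by blast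
  obtain x y p1' p2' where xy: "p1 = x # p1'" "p2 = p2' @ [y]"
    using s(7,8) by (metis list.exhaust rev_exhaust)
  have int: "internal (P d) = p1' @ p2'" "internal (p1 @ r' @ p2) = p1' @ r' @ p2'"
    using s(1) xy internal_Cons_snoc[of x "p1' @ p2'" y] internal_Cons_snoc[of x "p1' @ r' @ p2'" y]
    by simp_all
  have hdl: "hd (p1 @ r' @ p2) = hd (P d)" "last (p1 @ r' @ p2) = last (P d)"
    using s(1) xy by simp_all
  define P' where "P' = P(d := p1 @ r' @ p2)"
  define Q' where "Q' = Q(d := q1 @ es' @ q2)"
  have P'int: "set (internal (P' e)) = set (internal (P e)) \<union> (if e = d then set r else {})" for e
    using int r' by (auto simp: P'_def)
  \<comment> \<open>For \<open>e \<noteq> d\<close> nothing is removed, since \<open>g\<close>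
    belongs to \<open>Q d\<close> and the edge lists are disjoint.\<close>
  have Q'set: "set (Q' e) = set (Q e) - {g} \<union> (if e = d then set es else {})" if "e \<in> edges J" for e
    using s(2) gq r' disQ[OF that d(1)] d(2) by (auto simp: Q'_def)
  have intv: "set (internal (P e)) \<subseteq> verts H" if "e \<in> edges J" for e using vH that by blast
  have Qe: "set (Q e) \<subseteq> edges H" if "e \<in> edges J" for e using eH that by blast
  show ?thesis unfolding bisubdivision_def
  proof (rule exI[of _ f], rule exI[of _ P'], rule exI[of _ Q'], intro conjI ballI impI)
    show "inj_on f (verts J)" by fact
  next
    fix e assume e: "e \<in> edges J"
    show "is_path H' (P' e) (Q' e)"
      using new Hsub[OF path[OF e]] disQ[OF e d(1)] d by (auto simp: P'_def Q'_def)
    show "{hd (P' e), last (P' e)} = f ` ends J e"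
      using hl[OF e] hdl by (metis P'_def fun_upd_apply)
    show "even (length (internal (P' e)))"
      using evP[OF e] evP[OF d(1)] int r' ev by (auto simp: P'_def)
    show "set (internal (P' e)) \<inter> f ` verts J = {}"
      using intP[OF e] P'int[of e] fresh vH by auto
  next
    fix e e' assume e: "e \<in> edges J" "e' \<in> edges J" "e \<noteq> e'"
    show "set (internal (P' e)) \<inter> set (internal (P' e')) = {}"
      unfolding P'int using disP[OF e] fresh(1) intv[OF e(1)] intv[OF e(2)] e(3) by (simp; blast)
    show "set (Q' e) \<inter> set (Q' e') = {}"
      unfolding Q'set[OF e(1)] Q'set[OF e(2)]
      using disQ[OF e] fresh(2) Qe[OF e(1)] Qe[OF e(2)] e(3) by (simp; blast)
  next
    show "verts H' = f ` verts J \<union> (\<Union>e \<in> edges J. set (internal (P' e)))"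
      using vH' vH d(1) by (auto simp: P'int split: if_splits)
    show "edges H' = (\<Union>e \<in> edges J. set (Q' e))"
      using eH' eH d(1) by (auto simp: Q'set split: if_splits)
  qed
qed

text \<open>Used to pass from edges \<open>Some e\<close> to edges \<open>e\<close>. The vertex
  paths stay, and injectivity of \<open>h\<close> keeps the edge lists disjoint.\<close>

lemma bisubdivision_relabel_edges:
  assumes bis: "bisubdivision J H" and inj: "inj_on h (edges H)"
    and vH': "verts H' = verts H" and eH': "edges H' = h ` edges H"
    and ends: "\<And>e. e \<in> edges H \<Longrightarrow> ends H' (h e) = ends H e"
  shows "bisubdivision J H'"
proof -
  obtain f P Q where f: "inj_on f (verts J)"
    and path: "\<forall>e \<in> edges J. is_path H (P e) (Q e) \<and> {hd (P e), last (P e)} = f ` ends J e \<and>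
        even (length (internal (P e))) \<and> set (internal (P e)) \<inter> f ` verts J = {}"
    and dis: "\<forall>e \<in> edges J. \<forall>e' \<in> edges J. e \<noteq> e' \<longrightarrow>
        set (internal (P e)) \<inter> set (internal (P e')) = {} \<and> set (Q e) \<inter> set (Q e') = {}"
    and vH: "verts H = f ` verts J \<union> (\<Union>e \<in> edges J. set (internal (P e)))"
    and eH: "edges H = (\<Union>e \<in> edges J. set (Q e))"
    using bis unfolding bisubdivision_def by (elim exE conjE) blast
  have 1: "is_path H' (P e) (map h (Q e))" if "e \<in> edges J" for e
  proof -
    have "is_path H (P e) (Q e)" using path that by blast
    then show ?thesis using ends vH' eH' unfolding is_path_def by (auto simp: subset_iff)
  qed
  have 2: "set (map h (Q e)) \<inter> set (map h (Q e')) = {}"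
    if "e \<in> edges J" "e' \<in> edges J" "e \<noteq> e'" for e e'
  proof -
    have "set (Q e) \<inter> set (Q e') = {}" "set (Q e) \<subseteq> edges H" "set (Q e') \<subseteq> edges H"
      using dis that eH by blast+
    then show ?thesis
      using inj_on_image_Int[OF inj, of "set (Q e)" "set (Q e')"] by simp
  qed
  have "edges H' = (\<Union>e \<in> edges J. set (map h (Q e)))" using eH eH' by auto
  show ?thesis unfolding bisubdivision_def
  proof (rule exI[of _ f], rule exI[of _ P], rule exI[of _ "\<lambda>e. map h (Q e)"], intro conjI ballI impI)
    show "inj_on f (verts J)" by fact
    show "verts H' = f ` verts J \<union> (\<Union>e \<in> edges J. set (internal (P e)))" using vH vH' by simp
    show "edges H' = (\<Union>e \<in> edges J. set (map h (Q e)))" by fact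
  next
    fix e assume e: "e \<in> edges J"
    show "is_path H' (P e) (map h (Q e))" using 1[OF e] .
    show "{hd (P e), last (P e)} = f ` ends J e" "even (length (internal (P e)))"
      "set (internal (P e)) \<inter> f ` verts J = {}"
      using bspec[OF path e] by simp_all
  next
    fix e e' assume e: "e \<in> edges J" "e' \<in> edges J" "e \<noteq> e'"
    show "set (internal (P e)) \<inter> set (internal (P e')) = {}" using dis e by simp
    show "set (map h (Q e)) \<inter> set (map h (Q e')) = {}" using 2[OF e] .
  qed
qed

section \<open>Components\<close>

lemma sym_adj: "sym (adj G)"
  by (auto simp: sym_def adj_def insert_commute)

text \<open>Reachability is symmetric, so any vertex of a component can act as its
  representative.\<close>

lemma component_eq_class:
  assumes "C \<in> components G" "x \<in> C"
  shows "C = {y \<in> verts G. (x, y) \<in> (adj G)\<^sup>*}"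
proof -
  obtain u where C: "C = {v \<in> verts G. (u, v) \<in> (adj G)\<^sup>*}"
    using assms by (auto simp: components_def)
  then have ux: "(u, x) \<in> (adj G)\<^sup>*" using assms by auto
  then have "(x, u) \<in> (adj G)\<^sup>*" using sym_rtrancl[OF sym_adj] by (meson symD)
  then show ?thesis using C ux by (auto intro: rtrancl_trans)
qed

lemma components_disjoint:
  assumes "C \<in> components G" "D \<in> components G" "C \<noteq> D"
  shows "C \<inter> D = {}"
  using component_eq_class[of _ G] assms by blast

lemma Union_components: "\<Union> (components G) = verts G"
  by (auto simp: components_def)

lemma component_subset: "C \<in> components G \<Longrightarrow> C \<subseteq> verts G"
  by (auto simp: components_def)

lemma component_nonempty: "C \<in> components G \<Longrightarrow> C \<noteq> {}"
  by (auto simp: components_def)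

lemma component_delete_closed:
  assumes G: "multigraph G" and C: "C \<in> components (delete_verts G S)"
    and e: "e \<in> edges G" "ends G e = {x, y}" and "x \<in> C" "y \<notin> S"
  shows "y \<in> C"
proof -
  have "x \<in> verts G - S" using component_subset[OF C] \<open>x \<in> C\<close>
    by (auto simp: delete_verts_def induced_def)
  moreover have y: "y \<in> verts G - S" using G e \<open>y \<notin> S\<close> by (auto simp: multigraph_def)
  ultimately have "(x, y) \<in> adj (delete_verts G S)"
    using e by (auto simp: adj_def delete_verts_def induced_def)
  then show ?thesis using component_eq_class[OF C \<open>x \<in> C\<close>] y
    by (auto simp: delete_verts_def induced_def)
qed

section \<open>Two-separations\<close>

text \<open>Being matching covered supplies a perfect matching only through a given edge. An edge
  exists because two distinct vertices are connected.\<close>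

lemma matching_covered_obtain:
  assumes "matching_covered G"
  obtains M where "M \<subseteq> edges G" "matches (ends G) M (verts G)"
proof -
  have mg: "multigraph G" and con: "connected_graph G" and c2: "card (verts G) \<ge> 2"
    using assms by (auto simp: matching_covered_def)
  obtain x y where "x \<in> verts G" "y \<in> verts G" "x \<noteq> y"
    using obtain_subset_with_card_n[OF c2] by (metis card_2_iff insert_subset)
  then have "(x, y) \<in> (adj G)\<^sup>*" using con by (auto simp: connected_graph_def)
  then obtain z where "(x, z) \<in> adj G" using \<open>x \<noteq> y\<close> by (metis converse_rtranclE)
  then obtain e where "e \<in> edges G" by (auto simp: adj_def)
  then obtain M where "perfect_matching G M" using assms by (auto simp: matching_covered_def)
  then show thesis using that perfect_matching_iff[OF mg] by blast
qed

text \<open>The number of odd components of \<open>G - S\<close> is even, and it is at most 2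
  because a perfect matching sends them to distinct vertices of \<open>S\<close>. If it were
  positive, it would be 2 and \<open>S\<close> would be a barrier.\<close>

lemma two_separation_component_even:
  assumes sep: "two_separation G S" and L: "L \<in> components (delete_verts G S)"
  shows "even (card L)"
proof (rule ccontr)
  assume odd: "odd (card L)"
  let ?D = "delete_verts G S" and ?O = "odd_components (delete_verts G S)"
  have mc: "matching_covered G" and SV: "S \<subseteq> verts G" and S2: "card S = 2"
    and nb: "\<not> barrier G S" using sep by (auto simp: two_separation_def)
  have mg: "multigraph G" using mc by (simp add: matching_covered_def)
  then have fin: "finite (verts G)" by (simp add: multigraph_def)
  obtain M where M: "M \<subseteq> edges G" "matches (ends G) M (verts G)"
    using matching_covered_obtain[OF mc] .
  have vD: "verts ?D = verts G - S" by (auto simp: delete_verts_def induced_def)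
  have finC: "finite C" if "C \<in> components ?D" for C
    by (rule finite_subset[OF component_subset[OF that]]) (simp add: vD fin)
  have finD: "finite (components ?D)"
  proof (rule finite_subset)
    show "components ?D \<subseteq> Pow (verts ?D)" using component_subset by blast
  qed (simp add: vD fin)
  have "card (verts G - S) = card (verts G) - 2"
    using card_Diff_subset[OF finite_subset[OF SV fin] SV] S2 by simp
  then have "even (card (verts ?D))" using matches_even[OF M(2) fin] vD by simp
  moreover have "card (verts ?D) = (\<Sum>C \<in> components ?D. card C)"
  proof -
    have "card (\<Union> (components ?D)) = sum card (components ?D)"
    proof (rule card_Union_disjoint)
      show "pairwise disjnt (components ?D)"
        unfolding pairwise_def disjnt_def using components_disjoint by blast
    qed (rule finC)
    then show ?thesis by (simp add: Union_components)
  qed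
  ultimately have evenO: "even (card ?O)"
    using even_sum_iff[OF finD, of card] by (simp add: odd_components_def)
  \<comment> \<open>By parity an edge of \<open>M\<close> leaves \<open>C\<close>, and an edge that
    leaves a component of \<open>G - S\<close> ends in \<open>S\<close>.\<close>
  have "\<exists>s. \<exists>e \<in> M. \<exists>x. s \<in> S \<and> ends G e = {x, s} \<and> x \<in> C" if "C \<in> ?O" for C
  proof -
    have C: "C \<in> components ?D" "odd (card C)" using that by (auto simp: odd_components_def)
    have "C \<subseteq> verts G" using component_subset[OF C(1)] vD by blast
    from odd_matched_outside[OF M(2) fin this C(2)]
    obtain e x z where e: "e \<in> M" "ends G e = {x, z}" "x \<in> C" "z \<in> verts G - C" by blast
    then have "z \<in> S" using component_delete_closed[OF mg C(1) _ e(2,3)] M(1) by blast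
    then show ?thesis using e by blast
  qed
  then obtain t where t: "\<And>C. C \<in> ?O \<Longrightarrow> \<exists>e \<in> M. \<exists>x. t C \<in> S \<and> ends G e = {x, t C} \<and> x \<in> C"
    by metis
  \<comment> \<open>A vertex of \<open>S\<close> is on one edge of \<open>M\<close> only, whose
    other end determines the component.\<close>
  have "inj_on t ?O"
  proof (rule inj_onI)
    fix C C' assume C: "C \<in> ?O" "C' \<in> ?O" "t C = t C'"
    obtain e x where e: "e \<in> M" "t C \<in> S" "ends G e = {x, t C}" "x \<in> C" using t[OF C(1)] by blast
    obtain e' x' where e': "e' \<in> M" "t C' \<in> S" "ends G e' = {x', t C'}" "x' \<in> C'"
      using t[OF C(2)] by blast
    have cc: "C \<in> components ?D" "C' \<in> components ?D" using C by (auto simp: odd_components_def)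
    have "e = e'" using matches_unique[OF M(2) e(1) e'(1), of "t C"] e e' C(3) by auto
    moreover have "x \<notin> S" "x' \<notin> S" using component_subset[OF cc(1)] component_subset[OF cc(2)] e e' vD by auto
    ultimately have "x = x'" using e e' C(3) by (auto simp: doubleton_eq_iff)
    then show "C = C'" using components_disjoint[OF cc] e e' by blast
  qed
  moreover have "finite S" using finite_subset[OF SV fin] .
  ultimately have "card ?O \<le> 2" using card_inj_on_le[of t ?O S] t S2 by (metis image_subsetI)
  moreover have "card ?O > 0"
    using L odd finD by (auto simp: card_gt_0_iff odd_components_def)
  ultimately have "card ?O = 2" using evenO by presburger
  then have "barrier G S"
    using SV S2 M perfect_matching_iff[OF mg] by (auto simp: barrier_def has_perfect_matching_def)
  then show False using nb by blast
qed

lemma connected_crossing_edge: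
  assumes "multigraph G" "connected_graph G" "A \<subseteq> verts G" "A \<noteq> {}" "verts G - A \<noteq> {}"
  obtains e x y where "e \<in> edges G" "ends G e = {x, y}" "x \<in> A" "y \<in> verts G - A"
proof -
  obtain a b where ab: "a \<in> A" "b \<in> verts G - A" using assms by blast
  then have "(a, b) \<in> (adj G)\<^sup>*" using assms by (auto simp: connected_graph_def)
  \<comment> \<open>Induction along a walk from \<open>a\<close>: either the last step leaves
    \<open>A\<close>, or an earlier one did.\<close>
  then have "b \<notin> A \<longrightarrow> (\<exists>e x y. e \<in> edges G \<and> ends G e = {x, y} \<and> x \<in> A \<and> y \<notin> A)"
  proof (induction rule: rtrancl_induct)
    case (step y z)
    then show ?case by (auto simp: adj_def)
  qed (use ab in auto)
  then show thesis using that ab assms by (auto simp: multigraph_def) blast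
qed

text \<open>
  If \<open>s\<close> is matched into the even set \<open>A\<close>, then an odd number of vertices of \<open>A\<close> remains, so the
  other vertex of \<open>S\<close> is matched into \<open>A\<close> as well.
\<close>

lemma matching_into_side:
  assumes mc: "matching_covered G" and S2: "card S = 2"
    and V: "verts G = A \<union> S \<union> B" and dis: "A \<inter> S = {}" "A \<inter> B = {}" "S \<inter> B = {}"
    and A: "A \<noteq> {}" "even (card A)"
    and no: "\<And>e x y. e \<in> edges G \<Longrightarrow> ends G e = {x, y} \<Longrightarrow> x \<in> A \<Longrightarrow> y \<notin> B"
  obtains N K where "N \<subseteq> edges G" "K \<subseteq> edges G" "matches (ends G) N (A \<union> S)"
    "matches (ends G) K B" "\<And>e. e \<in> N \<Longrightarrow> ends G e \<inter> A \<noteq> {}"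
proof -
  have mg: "multigraph G" and con: "connected_graph G" using mc by (auto simp: matching_covered_def)
  have fin: "finite (verts G)" using mg by (simp add: multigraph_def)
  have Sne: "S \<noteq> {}" using S2 by auto
  obtain e a s where e: "e \<in> edges G" "ends G e = {a, s}" "a \<in> A" "s \<in> verts G - A"
    by (rule connected_crossing_edge[OF mg con, of A]) (use V A Sne dis in auto)
  have s: "s \<in> S" using no[OF e(1,2,3)] e(4) V by auto
  then obtain t where t: "S = {s, t}" "s \<noteq> t" using S2 by (auto simp: card_2_iff)
  obtain M where M: "M \<subseteq> edges G" "matches (ends G) M (verts G)" and eM: "e \<in> M"
    using mc e(1) perfect_matching_iff[OF mg] unfolding matching_covered_def by blast
  \<comment> \<open>The edge \<open>f\<close> of \<open>M\<close> that leaves this odd set cannot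
    start at \<open>s\<close>, which \<open>e\<close> already covers. It starts in \<open>A\<close>,
    cannot reach \<open>B\<close>, and so ends at \<open>t\<close>.\<close>
  have "odd (card (insert s A))"
    using A(2) s dis fin V by (subst card_insert_disjoint) auto
  moreover have "insert s A \<subseteq> verts G" using s V by auto
  ultimately obtain f b z where f: "f \<in> M" "ends G f = {b, z}" "b \<in> insert s A"
    "z \<in> verts G - insert s A"
    using odd_matched_outside[OF M(2) fin, of "insert s A"] by blast
  have "b \<noteq> s" using matches_unique[OF M(2) f(1) eM, of s] f e by (auto simp: doubleton_eq_iff)
  then have b: "b \<in> A" using f by auto
  then have "z \<notin> B" using no f M by blast
  then have z: "z = t" using f V t by auto
  \<comment> \<open>The only edges of \<open>M\<close> that meet \<open>S\<close> are
    \<open>e\<close> and \<open>f\<close>; hence no edge of \<open>M\<close> leaves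
    \<open>B\<close>.\<close>
  have SA: "\<exists>x \<in> A. \<exists>y \<in> S. ends G d = {x, y}" if "d \<in> M" "ends G d \<inter> S \<noteq> {}" for d
  proof -
    have "s \<in> ends G d \<or> t \<in> ends G d" using that t by blast
    then have "d = e \<or> d = f"
      using matches_unique[OF M(2) that(1) eM, of s] matches_unique[OF M(2) that(1) f(1), of t] e(2) f(2) z
      by auto
    then show ?thesis using e f b z s t by blast
  qed
  have BB: "ends G d \<subseteq> B" if d: "d \<in> M" "ends G d \<inter> B \<noteq> {}" for d
  proof -
    obtain y where y: "y \<in> ends G d" "y \<in> B" using d by blast
    obtain c x where cx: "c \<in> M" "ends G c = {y, x}" "x \<in> verts G"
      using matches_partner[OF M(2), of y] y V by blast
    have "d = c" using matches_unique[OF M(2) d(1) cx(1) y(1)] cx(2) by simp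
    then have x: "ends G d = {y, x}" "x \<in> verts G" using cx by simp_all
    have "ends G d \<inter> S = {}"
    proof (rule ccontr)
      assume "ends G d \<inter> S \<noteq> {}"
      from SA[OF d(1) this] obtain a' s' where "a' \<in> A" "s' \<in> S" "ends G d = {a', s'}" by auto
      then show False using y dis by auto
    qed
    moreover have "x \<notin> A" using no[of d x y] x y d M(1) by (auto simp: insert_commute)
    ultimately show ?thesis using x y V by auto
  qed
  have "matches (ends G) {d \<in> M. ends G d \<subseteq> B} B"
    by (rule matches_restrict[OF M(2) _ BB]) (use V in auto)
  moreover have "matches (ends G) {d \<in> M. ends G d \<subseteq> A \<union> S} (A \<union> S)"
  proof (rule matches_restrict[OF M(2)])
    show "A \<union> S \<subseteq> verts G" using V by auto
    show "ends G d \<subseteq> A \<union> S" if "d \<in> M" "ends G d \<inter> (A \<union> S) \<noteq> {}" for d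
    proof -
      have "\<not> ends G d \<subseteq> B" using that(2) dis by blast
      then have "ends G d \<inter> B = {}" using BB[OF that(1)] by blast
      then show ?thesis using matches_ends[OF M(2) that(1)] V by blast
    qed
  qed
  moreover have "ends G d \<inter> A \<noteq> {}" if "d \<in> {d \<in> M. ends G d \<subseteq> A \<union> S}" for d
  proof -
    have d: "d \<in> M" "ends G d \<subseteq> A \<union> S" using that by auto
    show ?thesis
    proof (cases "ends G d \<inter> S = {}")
      case True
      moreover have "ends G d \<noteq> {}" using matches_card[OF M(2) d(1)] by auto
      ultimately show ?thesis using d(2) by blast
    next
      case False
      from SA[OF d(1) this] show ?thesis by auto
    qed
  qed
  ultimately show thesis using that[of "{d \<in> M. ends G d \<subseteq> A \<union> S}" "{d \<in> M. ends G d \<subseteq> B}"] M(1) by blast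
qed

text \<open>Without the edge \<open>None\<close>, unwrapping by \<open>the\<close> turns
  \<open>H\<close> into a subgraph of \<open>G\<close>. Vertices of \<open>H\<close> may lie
  anywhere in \<open>G\<close>, so this also covers the case where \<open>None\<close> was replaced
  by a path outside the marked component.\<close>

lemma based_if_marked_avoids_new_edge:
  assumes G: "multigraph G" and H: "multigraph H" "bisubdivision J H" "verts H \<subseteq> verts G"
    and eH: "edges H \<subseteq> Some ` edges G" "\<And>e. Some e \<in> edges H \<Longrightarrow> ends H (Some e) = ends G e"
    and M: "M \<subseteq> edges G" "matches (ends G) M (verts G - verts H)"
  shows "based J G"
proof -
  define H' where "H' = \<lparr>verts = verts H, edges = the ` edges H, ends = ends G\<rparr>"
  have inj: "inj_on the (edges H)" by (rule inj_on_subset[OF _ eH(1)]) (auto simp: inj_on_def)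
  have ends: "ends H' (the e) = ends H e" if "e \<in> edges H" for e
    using that eH by (force simp: H'_def)
  have "bisubdivision J H'"
    by (rule bisubdivision_relabel_edges[OF H(2) inj _ _ ends]) (auto simp: H'_def)
  moreover have "multigraph H'"
    using H(1) ends unfolding multigraph_def by (auto simp: H'_def)
  then have "subgraph H' G" using H(3) eH(1) by (force simp: subgraph_def H'_def)
  then have "conformal H' G"
    using M has_perfect_matching_delete_iff[OF G] by (auto simp: conformal_def H'_def)
  ultimately show ?thesis by (auto simp: based_def)
qed

section \<open>Replacing the new edge by means of the other side of the separation\<close>

theorem theorem45:
  fixes J :: "('a, 'b) mgraph" and G :: "('v, 'e) mgraph" and S :: "'v set"
  assumes "matching_covered J" and "matching_covered G"
    and "two_separation G S"
    and "\<exists>L \<in> components (delete_verts G S). based J (marked_component G S L)"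
  shows "based J G"
proof -
  have mc: "matching_covered G" and SV: "S \<subseteq> verts G" and S2: "card S = 2"
    and disc: "\<not> connected_graph (delete_verts G S)"
    using assms(3) by (auto simp: two_separation_def)
  have mg: "multigraph G" using mc by (simp add: matching_covered_def)
  then have fin: "finite (verts G)" by (simp add: multigraph_def)
  obtain L where L: "L \<in> components (delete_verts G S)" "based J (marked_component G S L)"
    using assms(4) by blast
  define W where "W = verts G - S - L"
  have vD: "verts (delete_verts G S) = verts G - S" by (auto simp: delete_verts_def induced_def)
  have LV: "L \<subseteq> verts G - S" using component_subset[OF L(1)] vD by simp
  have V: "verts G = W \<union> S \<union> L" "verts G = L \<union> S \<union> W" using LV SV by (auto simp: W_def)
  have dis: "W \<inter> S = {}" "W \<inter> L = {}" "S \<inter> L = {}" "L \<inter> S = {}" "L \<inter> W = {}" "S \<inter> W = {}"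
    using LV by (auto simp: W_def)
  have no: "y \<notin> W" if "e \<in> edges G" "ends G e = {x, y}" "x \<in> L" for e x y
    using component_delete_closed[OF mg L(1) that] by (auto simp: W_def)
  have no': "y \<notin> L" if "e \<in> edges G" "ends G e = {x, y}" "x \<in> W" for e x y
    using no[of e y x] that by (auto simp: insert_commute)
  \<comment> \<open>Otherwise \<open>G - S\<close> would be the single component
    \<open>L\<close>.\<close>
  have W: "W \<noteq> {}"
  proof
    assume "W = {}"
    then have "L = verts (delete_verts G S)" using LV vD by (auto simp: W_def)
    then have "connected_graph (delete_verts G S)"
      unfolding connected_graph_def using component_eq_class[OF L(1)] by blast
    then show False using disc by blast
  qed
  have evL: "even (card L)" using two_separation_component_even[OF assms(3) L(1)] .
  have finS: "finite S" "finite W" "finite L" using fin V by (auto intro: finite_subset)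
  obtain M where "matches (ends G) M (verts G)" using matching_covered_obtain[OF mc] by blast
  then have "even (card (verts G))" using matches_even fin by blast
  moreover have "card (verts G) = card W + 2 + card L"
    using V(1) dis finS S2 by (simp add: card_Un_disjoint Int_Un_distrib2)
  ultimately have evW: "even (card W)" using evL by simp
  \<comment> \<open>Matching \<open>S\<close> into \<open>W\<close> gives \<open>N\<close>. Matching
    \<open>S\<close> into \<open>L\<close> leaves \<open>W\<close> matched within itself, which
    gives \<open>K\<close>.\<close>
  obtain N where N: "N \<subseteq> edges G" "matches (ends G) N (W \<union> S)" "\<And>e. e \<in> N \<Longrightarrow> ends G e \<inter> W \<noteq> {}"
    by (rule matching_into_side[OF mc S2 V(1) dis(1-3) W evW]) (erule (2) no', rule that)
  obtain K where K: "K \<subseteq> edges G" "matches (ends G) K W"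
    by (rule matching_into_side[OF mc S2 V(2) dis(4-6) component_nonempty[OF L(1)] evL])
      (erule (2) no, rule that)
  let ?D = "marked_component G S L"
  have Dv: "verts ?D = L \<union> S" using V by (auto simp: marked_component_def induced_def)
  have De: "edges ?D = insert None (Some ` {e \<in> edges G. ends G e \<subseteq> L \<union> S})"
    by (auto simp: marked_component_def induced_def)
  have Dn: "ends ?D = case_option S (ends G)" by (simp add: marked_component_def)
  have mD: "multigraph ?D"
    using finS mg S2 unfolding multigraph_def Dv De Dn by auto
  obtain H M where H: "subgraph H ?D" "bisubdivision J H"
    and M: "M \<subseteq> edges ?D" "matches (ends ?D) M (L \<union> S - verts H)"
    using L(2) has_perfect_matching_delete_iff[OF mD] unfolding based_def conformal_def Dv by blast
  have mH: "multigraph H" and vH: "verts H \<subseteq> L \<union> S" and eH: "edges H \<subseteq> edges ?D"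
    and nH: "\<And>e. e \<in> edges H \<Longrightarrow> ends H e = case_option S (ends G) e"
    using H(1) Dv Dn by (auto simp: subgraph_def)
  have vHG: "verts H \<subseteq> verts G" using vH V by blast
  define M' where "M' = {e. Some e \<in> M}"
  have M'G: "M' \<subseteq> edges G" using M(1) De by (auto simp: M'_def)
  have M'eq: "Some ` M' = M - {None}"
    by (auto simp: M'_def image_iff) (metis option.exhaust)
  \<comment> \<open>Dropping \<open>None\<close> from \<open>M\<close> uncovers exactly its two
    ends, the vertices of \<open>S\<close>.\<close>
  have M': "matches (ends G) M' (L \<union> S - verts H - (if None \<in> M then S else {}))"
  proof -
    have "matches (case_option S (ends G)) (Some ` M') (L \<union> S - verts H - (if None \<in> M then S else {}))"
      using M(2) matches_remove[OF M(2), of None] unfolding M'eq Dn by auto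
    then show ?thesis by (simp add: matches_Some)
  qed
  show ?thesis
  proof (cases "None \<in> edges H")
    case False
    then have eHG: "edges H \<subseteq> Some ` edges G" using eH De by auto
    have nH': "ends H (Some e) = ends G e" if "Some e \<in> edges H" for e using nH[OF that] by simp
    obtain M'' where "M'' \<subseteq> edges G" "matches (ends G) M'' (verts G - verts H)"
    proof (cases "None \<in> M")
      case True
      then have "S \<subseteq> L \<union> S - verts H" using matches_ends[OF M(2) True] Dn by simp
      then have "verts G - verts H = (L \<union> S - verts H - S) \<union> (W \<union> S)" using V vH dis by blast
      moreover have "(L \<union> S - verts H - S) \<inter> (W \<union> S) = {}" using dis by blast
      ultimately show thesis using matches_union[OF _ N(2)] M' M'G N(1) True that[of "M' \<union> N"] by simp
    next
      case False
      have "verts G - verts H = (L \<union> S - verts H) \<union> W" using V vH dis by blast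
      moreover have "(L \<union> S - verts H) \<inter> W = {}" using dis by blast
      ultimately show thesis using matches_union[OF _ K(2)] M' M'G K(1) False that[of "M' \<union> K"] by simp
    qed
    then show ?thesis
      using based_if_marked_avoids_new_edge[OF mg mH H(2) vHG eHG nH'] by blast
  next
    case True
    obtain u v where uv: "S = {u, v}" "u \<noteq> v" using S2 by (auto simp: card_2_iff)
    \<comment> \<open>The ends of \<open>None\<close> now belong to \<open>H\<close>, so
      \<open>M\<close>, which avoids \<open>H\<close>, cannot contain \<open>None\<close>.\<close>
    have SH: "S \<subseteq> verts H" using mH nH[OF True] True by (auto simp: multigraph_def)
    then have "None \<notin> M" using matches_ends[OF M(2), of None] Dn uv by auto
    then have M'2: "matches (ends G) M' (L \<union> S - verts H)" using M' by simp
    have "\<exists>r es. is_path G (u # r @ [v]) es \<and> set es \<subseteq> N \<union> K \<and> even (length r) \<and> set r \<subseteq> W \<and>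
        (\<exists>N' \<subseteq> N. matches (ends G) N' (W - set r))"
      by (rule alternating_path[OF _ uv(2) _ _ _ K(2) N(1) K(1)]) (use uv(1) finS dis N(2) V in auto)
    then obtain r es N' where r: "is_path G (u # r @ [v]) es" "set es \<subseteq> N \<union> K" "even (length r)"
      "set r \<subseteq> W" "N' \<subseteq> N" "matches (ends G) N' (W - set r)"
      by (elim exE conjE)
    \<comment> \<open>The edges stay wrapped in \<open>Some\<close>, so the kept edges of
      \<open>H\<close> need no renaming at this point.\<close>
    define H' where "H' = \<lparr>verts = verts H \<union> set r, edges = edges H - {None} \<union> Some ` set es,
      ends = case_option S (ends G)\<rparr>"
    have esG: "set es \<subseteq> edges G" using r N K by blast
    \<comment> \<open>This makes the path edges new to \<open>H\<close>. In particular none of them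
      joins the two vertices of \<open>S\<close> directly; such an edge of \<open>G\<close> could
      already be in \<open>H\<close>.\<close>
    have esW: "ends G e \<inter> W \<noteq> {}" if "e \<in> set es" for e
    proof (cases "e \<in> N")
      case False
      then have "e \<in> K" using r that by blast
      then have "ends G e \<subseteq> W" "ends G e \<noteq> {}"
        using matches_ends[OF K(2)] matches_card[OF K(2), of e] by auto
      then show ?thesis by blast
    qed (use N in auto)
    have bis: "bisubdivision J H'"
    proof (rule bisubdivision_replace_edge[OF H(2) True _ uv(2), where r = r and es = "map Some es"])
      show "ends H None = {u, v}" using nH[OF True] uv by simp
      show "is_path H' (u # r @ [v]) (map Some es)"
        using r(1) SH uv unfolding is_path_def H'_def by auto
      show "set r \<inter> verts H = {}" using r vH dis by blast
      show "set (map Some es) \<inter> edges H = {}" using esW eH De dis by fastforce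
    qed (use nH r in \<open>auto simp: H'_def\<close>)
    have esv: "ends G e \<subseteq> verts H \<union> set r" if "e \<in> set es" for e
      using is_path_ends[OF r(1) that] SH uv by auto
    have "ends H' e \<subseteq> verts H' \<and> card (ends H' e) = 2" if e: "e \<in> edges H'" for e
    proof (cases "e \<in> edges H")
      case True
      then have "ends H e \<subseteq> verts H \<and> card (ends H e) = 2" using mH by (auto simp: multigraph_def)
      then show ?thesis using nH[OF True] by (auto simp: H'_def)
    next
      case False
      then obtain d where "e = Some d" "d \<in> set es" using e by (auto simp: H'_def)
      then show ?thesis using esv[of d] esG mg by (auto simp: H'_def multigraph_def)
    qed
    moreover have "finite (verts H')" "finite (edges H')"
      using mH by (auto simp: multigraph_def H'_def)
    ultimately have mH': "multigraph H'" by (simp add: multigraph_def)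
    have vH': "verts H' \<subseteq> verts G" using vHG r V by (auto simp: H'_def)
    have eH': "edges H' \<subseteq> Some ` edges G" using eH De esG by (auto simp: H'_def)
    have nH': "ends H' (Some e) = ends G e" for e by (simp add: H'_def)
    \<comment> \<open>The first part is matched by \<open>M'\<close>, the vertices of
      \<open>W\<close> off the path by \<open>N'\<close>.\<close>
    have "verts G - verts H' = (L \<union> S - verts H) \<union> (W - set r)"
      using V vH dis r(4) by (auto simp: H'_def)
    moreover have "(L \<union> S - verts H) \<inter> (W - set r) = {}" using dis by blast
    ultimately have match: "matches (ends G) (M' \<union> N') (verts G - verts H')"
      using matches_union[OF M'2 r(6)] by simp
    have "M' \<union> N' \<subseteq> edges G" using M'G r(5) N(1) by blast
    then show ?thesis
      using based_if_marked_avoids_new_edge[OF mg mH' bis vH' eH' nH' _ match] by simp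
  qed
qed

end
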